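(* An associative ring $R$ with unity is periodic if and only if $R$ is pseudo $\pi$-polar and $J(R)$ is nil.
   Context: For a ring $R$, $J(R)$ is the Jacobson radical and $\sqrt{J(R)}=\{x\in R: x^k\in J(R)\text{ for some }k\ge 1\}$. For $x\in R$: $\mathrm{comm}(x)=\{y\in R: xy=yx\}$ and $\mathrm{comm}^2(x)=\{y\in R: yz=zy\text{ for all }z\in\mathrm{comm}(x)\}$. A ring $R$ is periodic if for each $a\in R$ there are integers $m>n\ge 1$ with $a^m=a^n$. A ring $R$ is pseudo $\pi$-polar if for each $a\in R$ there exist an integer $n\ge 1$ (depending on $a$) and $e\in R$ with $e^2=e\in\mathrm{comm}^2(a)$ such that $a^n-e\in\sqrt{J(R)}$. "$J(R)$ is nil" means every element of $J(R)$ is nilpotent. *)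

theory Defs
  imports "HOL-Algebra.Ideal"
begin

text \<open>
  Rings are the unital, associative, not necessarily commutative rings of \<^locale>\<open>ring\<close>;
  the zero ring is included. The library's \<^locale>\<open>maximalideal\<close> is two-sided, so the one-sided
  version needed for the Jacobson radical is introduced here.
\<close>

definition left_ideal :: "'a set \<Rightarrow> ('a, 'b) ring_scheme \<Rightarrow> bool" where
  "left_ideal I R \<longleftrightarrow>
     additive_subgroup I R \<and> (\<forall>r\<in>carrier R. \<forall>x\<in>I. r \<otimes>\<^bsub>R\<^esub> x \<in> I)"

definition maximal_left_ideal :: "'a set \<Rightarrow> ('a, 'b) ring_scheme \<Rightarrow> bool" where
  "maximal_left_ideal M R \<longleftrightarrow>
     left_ideal M R \<and> M \<noteq> carrier R \<and>
     (\<forall>I. left_ideal I R \<longrightarrow> M \<subseteq> I \<longrightarrow> I = M \<or> I = carrier R)"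

text \<open>The intersection with the carrier matters only for the zero ring, which has no maximal
  left ideal and is its own radical.\<close>

definition jacobson_radical :: "('a, 'b) ring_scheme \<Rightarrow> 'a set" where
  "jacobson_radical R = carrier R \<inter> \<Inter>{M. maximal_left_ideal M R}"

definition sqrt_jacobson_radical :: "('a, 'b) ring_scheme \<Rightarrow> 'a set" where
  "sqrt_jacobson_radical R =
     {x \<in> carrier R. \<exists>k::nat. k \<ge> 1 \<and> x [^]\<^bsub>R\<^esub> k \<in> jacobson_radical R}"

definition ring_commutant :: "('a, 'b) ring_scheme \<Rightarrow> 'a \<Rightarrow> 'a set" where
  "ring_commutant R x = {y \<in> carrier R. x \<otimes>\<^bsub>R\<^esub> y = y \<otimes>\<^bsub>R\<^esub> x}"

definition ring_double_commutant :: "('a, 'b) ring_scheme \<Rightarrow> 'a \<Rightarrow> 'a set" where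
  "ring_double_commutant R x =
     {y \<in> carrier R. \<forall>z\<in>ring_commutant R x. y \<otimes>\<^bsub>R\<^esub> z = z \<otimes>\<^bsub>R\<^esub> y}"

definition nil_subset :: "'a set \<Rightarrow> ('a, 'b) ring_scheme \<Rightarrow> bool" where
  "nil_subset A R \<longleftrightarrow> (\<forall>x\<in>A. \<exists>k::nat. k \<ge> 1 \<and> x [^]\<^bsub>R\<^esub> k = \<zero>\<^bsub>R\<^esub>)"

definition periodic_ring :: "('a, 'b) ring_scheme \<Rightarrow> bool" where
  "periodic_ring R \<longleftrightarrow>
     (\<forall>a\<in>carrier R. \<exists>m n::nat. m > n \<and> n \<ge> 1 \<and> a [^]\<^bsub>R\<^esub> m = a [^]\<^bsub>R\<^esub> n)"

definition pseudo_pi_polar :: "('a, 'b) ring_scheme \<Rightarrow> bool" where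
  "pseudo_pi_polar R \<longleftrightarrow>
     (\<forall>a\<in>carrier R. \<exists>n::nat. n \<ge> 1 \<and>
        (\<exists>e\<in>ring_double_commutant R a. e [^]\<^bsub>R\<^esub> (2::nat) = e \<and>
           a [^]\<^bsub>R\<^esub> n \<ominus>\<^bsub>R\<^esub> e \<in> sqrt_jacobson_radical R))"

end

theory Submission
  imports Defs "HOL-Algebra.Subrings"
begin

text \<open>
  In a periodic ring some power \<open>a\<^sup>k\<close> is idempotent and lies in the double commutant of \<open>a\<close>, which
  gives pseudo \<open>\<pi>\<close>-polarity; the radical contains no nonzero idempotent, so it is nil.

  Conversely, nilness of the radical turns pseudo \<open>\<pi>\<close>-polarity into \<open>a\<^sup>n = e + w\<close> with \<open>e\<close> idempotent,
  \<open>w\<close> nilpotent and both in the commutative ring formed by the double commutant of \<open>a\<close>. For \<open>a = 2\<close>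
  this makes \<open>4\<^sup>n - 2\<^sup>n\<close> nilpotent, so the characteristic is positive. If \<open>N \<ge> 2\<close> kills the ring, then
  \<open>(e + x)\<^sup>N \<in> e + (x\<^sup>2)\<close>, and iterating the \<open>N\<close>-th power moves \<open>e + w\<close> to \<open>e\<close>.
\<close>

section \<open>Idempotents and the Jacobson radical\<close>

text \<open>Closure under negatives comes for free, since \<open>\<ominus> x\<close> is
  \<open>(\<ominus> \<one>) \<otimes> x\<close>. This leaves only elementwise conditions to check
  later.\<close>

lemma (in ring) left_ideal_iff:
  "left_ideal I R \<longleftrightarrow>
     I \<subseteq> carrier R \<and> \<zero> \<in> I \<and> (\<forall>x\<in>I. \<forall>y\<in>I. x \<oplus> y \<in> I) \<and> (\<forall>r\<in>carrier R. \<forall>x\<in>I. r \<otimes> x \<in> I)"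
    (is "_ \<longleftrightarrow> ?rhs")
proof
  assume "left_ideal I R"
  then have "additive_subgroup I R" and mult: "\<forall>r\<in>carrier R. \<forall>x\<in>I. r \<otimes> x \<in> I"
    by (auto simp: left_ideal_def)
  interpret additive_subgroup I R by fact
  show ?rhs using mult a_subset by auto
next
  assume I: ?rhs
  have "\<ominus> x \<in> I" if "x \<in> I" for x
  proof -
    have "(\<ominus> \<one>) \<otimes> x \<in> I" using I that by auto
    moreover have "(\<ominus> \<one>) \<otimes> x = \<ominus> x" using I that l_minus[of \<one> x] by auto
    ultimately show ?thesis by simp
  qed
  then have "subgroup I (add_monoid R)"
    using I by (intro add.subgroupI) (auto simp: a_inv_def)
  then show "left_ideal I R"
    using I by (auto simp: left_ideal_def intro: additive_subgroupI)
qed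

lemma (in ring) left_ideal_eq_carrier_iff:
  assumes "left_ideal I R"
  shows "I = carrier R \<longleftrightarrow> \<one> \<in> I"
proof
  assume "\<one> \<in> I"
  then have "r \<in> I" if "r \<in> carrier R" for r
    using assms that r_one[OF that] unfolding left_ideal_iff by metis
  then show "I = carrier R" using assms by (auto simp: left_ideal_iff)
qed auto

text \<open>Zorn's lemma applies because properness is expressed as
  \<open>\<one> \<notin> K\<close>, a condition that survives unions of chains.\<close>

lemma (in ring) exists_maximal_left_ideal:
  assumes "left_ideal I R" "I \<noteq> carrier R"
  obtains M where "maximal_left_ideal M R" "I \<subseteq> M"
proof -
  define A where "A = {K. left_ideal K R \<and> I \<subseteq> K \<and> \<one> \<notin> K}"
  have "\<exists>M\<in>A. \<forall>K\<in>A. M \<subseteq> K \<longrightarrow> K = M"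
  proof (rule subset_Zorn_nonempty)
    show "A \<noteq> {}"
      using assms left_ideal_eq_carrier_iff by (auto simp: A_def)
  next
    fix C assume "C \<noteq> {}" and chain: "subset.chain A C"
    then have C: "\<And>K. K \<in> C \<Longrightarrow> left_ideal K R \<and> I \<subseteq> K \<and> \<one> \<notin> K"
      by (auto simp: A_def subset.chain_def)
    have "x \<oplus> y \<in> \<Union>C" if "x \<in> K" "K \<in> C" "y \<in> L" "L \<in> C" for x y K L
    proof -
      have "K \<subseteq> L \<or> L \<subseteq> K"
        using chain that by (auto simp: subset_chain_def)
      then obtain P where "P \<in> C" "x \<in> P" "y \<in> P"
        using \<open>x \<in> K\<close> \<open>K \<in> C\<close> \<open>y \<in> L\<close> \<open>L \<in> C\<close> by blast
      moreover have "x \<oplus> y \<in> P" using C calculation by (auto simp: left_ideal_iff)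
      ultimately show ?thesis by blast
    qed
    moreover have "\<zero> \<in> \<Union>C"
      using C \<open>C \<noteq> {}\<close> by (auto simp: left_ideal_iff)
    moreover have "\<Union>C \<subseteq> carrier R" "\<forall>r\<in>carrier R. \<forall>x\<in>\<Union>C. r \<otimes> x \<in> \<Union>C"
      using C unfolding left_ideal_iff by blast+
    ultimately have "left_ideal (\<Union>C) R"
      by (auto simp: left_ideal_iff)
    then show "\<Union>C \<in> A" using C \<open>C \<noteq> {}\<close> by (auto simp: A_def)
  qed
  then obtain M where M: "M \<in> A" "\<And>K. K \<in> A \<Longrightarrow> M \<subseteq> K \<Longrightarrow> K = M" by blast
  have "K = M \<or> K = carrier R" if "left_ideal K R" "M \<subseteq> K" for K
    using M that left_ideal_eq_carrier_iff[of K] unfolding A_def by blast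
  then have "maximal_left_ideal M R"
    using M(1) left_ideal_eq_carrier_iff[of M] by (auto simp: A_def maximal_left_ideal_def)
  then show ?thesis using that M(1) by (auto simp: A_def)
qed

lemma (in ring) left_ideal_jacobson_radical: "left_ideal (jacobson_radical R) R"
  by (auto simp: left_ideal_iff jacobson_radical_def maximal_left_ideal_def)

lemma (in ring) jacobson_radical_pow_closed:
  assumes "x \<in> jacobson_radical R" "(k::nat) \<ge> 1"
  shows "x [^] k \<in> jacobson_radical R"
proof -
  obtain j where "k = Suc j" using assms(2) by (cases k) auto
  moreover have "x \<in> carrier R" using assms(1) by (simp add: jacobson_radical_def)
  ultimately show ?thesis
    using assms(1) left_ideal_jacobson_radical by (auto simp: left_ideal_iff)
qed

text \<open>A maximal left ideal containing \<open>\<one> \<ominus> e\<close> would also contain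
  \<open>e\<close>, hence \<open>\<one>\<close>. So \<open>\<one> \<ominus> e\<close> has a left
  inverse \<open>u\<close>, and multiplying
  \<open>(\<one> \<ominus> e) \<otimes> e = \<zero>\<close> by \<open>u\<close> leaves
  \<open>e = \<zero>\<close>.\<close>

lemma (in ring) idempotent_in_jacobson_radical:
  assumes "e \<in> jacobson_radical R" "e \<otimes> e = e"
  shows "e = \<zero>"
proof -
  have e: "e \<in> carrier R" using assms(1) by (simp add: jacobson_radical_def)
  define I where "I = (\<lambda>r. r \<otimes> (\<one> \<ominus> e)) ` carrier R"
  have I: "left_ideal I R"
    unfolding left_ideal_iff
  proof (intro conjI ballI)
    show "I \<subseteq> carrier R" using e by (auto simp: I_def)
    show "\<zero> \<in> I" unfolding I_def using e by (intro image_eqI[of _ _ \<zero>]) auto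
  next
    fix x y assume "x \<in> I" "y \<in> I"
    then show "x \<oplus> y \<in> I" using e by (auto simp: I_def l_distr[symmetric])
  next
    fix r x assume "r \<in> carrier R" "x \<in> I"
    then show "r \<otimes> x \<in> I" using e by (auto simp: I_def m_assoc[symmetric])
  qed
  have "\<one> \<in> I"
  proof (rule ccontr)
    assume "\<one> \<notin> I"
    then obtain M where M: "maximal_left_ideal M R" "I \<subseteq> M"
      using exists_maximal_left_ideal[OF I] left_ideal_eq_carrier_iff[OF I] by blast
    have "left_ideal M R" using M(1) by (simp add: maximal_left_ideal_def)
    have "\<one> \<otimes> (\<one> \<ominus> e) \<in> M" using M(2) by (auto simp: I_def)
    then have "\<one> \<ominus> e \<in> M" using e by simp
    moreover have "e \<in> M" using assms(1) M(1) by (auto simp: jacobson_radical_def)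
    ultimately have "(\<one> \<ominus> e) \<oplus> e \<in> M"
      using \<open>left_ideal M R\<close> by (auto simp: left_ideal_iff)
    moreover have "(\<one> \<ominus> e) \<oplus> e = \<one>"
      using e by algebra
    ultimately show False
      using M(1) left_ideal_eq_carrier_iff[OF \<open>left_ideal M R\<close>] by (simp add: maximal_left_ideal_def)
  qed
  then obtain u where u: "u \<in> carrier R" "u \<otimes> (\<one> \<ominus> e) = \<one>" by (auto simp: I_def)
  have "(\<one> \<ominus> e) \<otimes> e = \<zero>" using e assms(2) by (simp add: minus_eq l_distr l_minus r_neg)
  then have "u \<otimes> ((\<one> \<ominus> e) \<otimes> e) = \<zero>" using u(1) by simp
  then show ?thesis using u e by (simp add: m_assoc[symmetric])
qed

section \<open>Periodic elements\<close>

text \<open>From exponent \<open>n\<close> on, the powers of \<open>a\<close> repeat with period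
  \<open>d = m - n\<close>. The exponent \<open>n * d\<close> lies in this range and is a multiple
  of the period, so doubling it does not change the power.\<close>

lemma (in monoid) idempotent_power:
  assumes a: "a \<in> carrier G" and "n < m" "n \<ge> 1" "a [^] (m::nat) = a [^] (n::nat)"
  obtains k :: nat where "k \<ge> 1" "a [^] k \<otimes> a [^] k = a [^] k"
proof
  define d where "d = m - n"
  have d: "d \<ge> 1" "n + d = m" using assms by (auto simp: d_def)
  have step: "a [^] (n + j + d) = a [^] (n + j)" for j
  proof -
    have "a [^] (n + j + d) = a [^] m \<otimes> a [^] j"
      using a by (simp add: nat_pow_mult ac_simps flip: d(2))
    then show ?thesis using a assms(4) by (simp add: nat_pow_mult)
  qed
  have per: "a [^] (n + j + i * d) = a [^] (n + j)" for i j
  proof (induction i)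
    case (Suc i)
    have "a [^] (n + j + Suc i * d) = a [^] (n + (j + i * d) + d)" by (simp add: ac_simps)
    also have "\<dots> = a [^] (n + (j + i * d))" by (rule step)
    finally show ?case using Suc by (simp add: ac_simps)
  qed simp
  \<comment> \<open>The truncated subtraction is harmless because \<open>d \<ge> 1\<close>; the
    offset \<open>j = n * d - n\<close> makes \<open>per\<close> start at exponent
    \<open>n * d\<close>, and \<open>i = n\<close> periods double it.\<close>
  have "n + (n * d - n) = n * d" using d by simp
  then have "a [^] (n * d + n * d) = a [^] (n * d)"
    using per[of "n * d - n" n] by simp
  then show "a [^] (n * d) \<otimes> a [^] (n * d) = a [^] (n * d)"
    using a by (simp add: nat_pow_mult)
  show "n * d \<ge> 1" using d assms by simp
qed

lemma (in ring) nat_pow_in_double_commutant: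
  assumes a: "a \<in> carrier R"
  shows "a [^] (k::nat) \<in> ring_double_commutant R a"
proof -
  have "a [^] k \<otimes> z = z \<otimes> a [^] k" if z: "z \<in> carrier R" "a \<otimes> z = z \<otimes> a" for z
    using group_commutes_pow[OF z(2) a z(1)] .
  then show ?thesis
    using a by (auto simp: ring_double_commutant_def ring_commutant_def)
qed

lemma (in ring) periodic_imp_pseudo_pi_polar:
  assumes "periodic_ring R"
  shows "pseudo_pi_polar R"
  unfolding pseudo_pi_polar_def
proof
  fix a assume a: "a \<in> carrier R"
  then obtain m n :: nat where "n < m" "n \<ge> 1" "a [^] m = a [^] n"
    using assms by (auto simp: periodic_ring_def)
  then obtain k :: nat where k: "k \<ge> 1" "a [^] k \<otimes> a [^] k = a [^] k"
    using idempotent_power[OF a] by blast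
  \<comment> \<open>The idempotent chosen is \<open>a [^] k\<close> itself, so the difference to be
    placed in the root of the radical is zero.\<close>
  have "\<zero> [^] (1::nat) \<in> jacobson_radical R"
    using left_ideal_jacobson_radical by (auto simp: left_ideal_iff)
  then have "a [^] k \<ominus> a [^] k \<in> sqrt_jacobson_radical R"
    using a by (auto simp: sqrt_jacobson_radical_def r_neg minus_eq)
  moreover have "(a [^] k) [^] (2::nat) = a [^] k"
    using a k(2) by (simp add: numeral_2_eq_2)
  ultimately show "\<exists>n::nat. n \<ge> 1 \<and> (\<exists>e\<in>ring_double_commutant R a.
      e [^] (2::nat) = e \<and> a [^] n \<ominus> e \<in> sqrt_jacobson_radical R)"
    using k(1) nat_pow_in_double_commutant[OF a] by blast
qed

lemma (in ring) periodic_imp_nil_jacobson_radical: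
  assumes "periodic_ring R"
  shows "nil_subset (jacobson_radical R) R"
  unfolding nil_subset_def
proof
  fix x assume x: "x \<in> jacobson_radical R"
  then have c: "x \<in> carrier R" by (simp add: jacobson_radical_def)
  then obtain m n :: nat where "n < m" "n \<ge> 1" "x [^] m = x [^] n"
    using assms by (auto simp: periodic_ring_def)
  then obtain k :: nat where k: "k \<ge> 1" "x [^] k \<otimes> x [^] k = x [^] k"
    using idempotent_power[OF c] by blast
  then show "\<exists>k::nat. k \<ge> 1 \<and> x [^] k = \<zero>"
    using idempotent_in_jacobson_radical jacobson_radical_pow_closed[OF x] by blast
qed

section \<open>The double commutant\<close>

text \<open>Commutativity holds because \<open>a\<close> commutes with itself: each element of the
  double commutant then commutes with \<open>a\<close>, so it lies in the commutant, with which all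
  the others commute. This makes the \<open>cring\<close> lemmas below available in a noncommutative
  ring.\<close>

lemma (in ring) subcring_double_commutant:
  assumes a: "a \<in> carrier R"
  shows "subcring (ring_double_commutant R a) R"
proof (rule subcringI)
  show "subring (ring_double_commutant R a) R"
  proof (rule subringI)
    fix h k assume hk: "h \<in> ring_double_commutant R a" "k \<in> ring_double_commutant R a"
    have "h \<otimes> k \<otimes> z = z \<otimes> (h \<otimes> k)" if "z \<in> ring_commutant R a" for z
    proof -
      have c: "h \<in> carrier R" "k \<in> carrier R" "z \<in> carrier R" "h \<otimes> z = z \<otimes> h" "k \<otimes> z = z \<otimes> k"
        using hk that by (auto simp: ring_double_commutant_def ring_commutant_def)
      have "h \<otimes> k \<otimes> z = h \<otimes> z \<otimes> k" using c(1-3,5) by (simp add: m_assoc)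
      also have "\<dots> = z \<otimes> (h \<otimes> k)" using c(1-3) by (simp add: c(4) m_assoc)
      finally show ?thesis .
    qed
    then show "h \<otimes> k \<in> ring_double_commutant R a"
      using hk by (auto simp: ring_double_commutant_def)
    show "h \<oplus> k \<in> ring_double_commutant R a"
      using hk by (auto simp: ring_double_commutant_def ring_commutant_def l_distr r_distr)
  qed (auto simp: ring_double_commutant_def ring_commutant_def l_minus r_minus)
next
  fix h k assume h: "h \<in> ring_double_commutant R a" and k: "k \<in> ring_double_commutant R a"
  have "k \<otimes> a = a \<otimes> k" using a k by (auto simp: ring_double_commutant_def ring_commutant_def)
  then have "k \<in> ring_commutant R a" using k by (simp add: ring_double_commutant_def ring_commutant_def)
  then show "h \<otimes> k = k \<otimes> h" using h by (simp add: ring_double_commutant_def)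
qed

section \<open>Idempotent plus nilpotent\<close>

text \<open>The binomial expansion modulo \<open>x \<otimes> x\<close>, with idempotence collapsing
  the powers of \<open>e\<close>. Exponents start at 2 because for exponent 1 the linear term is
  \<open>x\<close> rather than \<open>e \<otimes> x\<close>.\<close>

lemma (in cring) idempotent_add_pow:
  assumes e: "e \<in> carrier R" "e \<otimes> e = e" and x: "x \<in> carrier R"
  shows "\<exists>d\<in>carrier R. (e \<oplus> x) [^] (m + 2 :: nat) = e \<oplus> [(m + 2)] \<cdot> (e \<otimes> x) \<oplus> x \<otimes> x \<otimes> d"
proof (induction m)
  case 0
  have "(e \<oplus> x) \<otimes> (e \<oplus> x) = e \<otimes> e \<oplus> (e \<otimes> x \<oplus> e \<otimes> x) \<oplus> x \<otimes> x \<otimes> \<one>"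
    using e(1) x by algebra
  then show ?case using e x
    by (intro bexI[of _ \<one>]) (simp_all add: numeral_2_eq_2)
next
  case (Suc m)
  then obtain d where d: "d \<in> carrier R"
    "(e \<oplus> x) [^] (m + 2) = e \<oplus> [(m + 2)] \<cdot> (e \<otimes> x) \<oplus> x \<otimes> x \<otimes> d" by blast
  \<comment> \<open>Hiding the integer multiple in a ring element \<open>q\<close> leaves a plain
    polynomial identity for \<open>algebra\<close>.\<close>
  define q where "q = [(m + 2)] \<cdot> e"
  have q: "q \<in> carrier R" "q \<otimes> e = q" "[(m + 2)] \<cdot> (e \<otimes> x) = q \<otimes> x"
    using e x by (simp_all only: q_def add_pow_ldistr add.nat_pow_closed)
  have "(e \<oplus> x) [^] (Suc m + 2) = (e \<oplus> q \<otimes> x \<oplus> x \<otimes> x \<otimes> d) \<otimes> (e \<oplus> x)"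
    using d(2) q(3) by simp
  also have "\<dots> = e \<otimes> e \<oplus> ((q \<otimes> e) \<otimes> x \<oplus> e \<otimes> x) \<oplus> x \<otimes> x \<otimes> (d \<otimes> e \<oplus> q \<oplus> x \<otimes> d)"
    using e(1) x q(1) d(1) by algebra
  also have "\<dots> = e \<oplus> [(Suc m + 2)] \<cdot> (e \<otimes> x) \<oplus> x \<otimes> x \<otimes> (d \<otimes> e \<oplus> q \<oplus> x \<otimes> d)"
    using e q x by simp
  finally show ?case using d(1) q(1) e(1) x by blast
qed

text \<open>Each further \<open>N\<close>-th power kills the linear term, since \<open>N\<close>
  annihilates the ring, and so replaces the error \<open>x\<close> by a multiple of
  \<open>x \<otimes> x\<close>. Gaining a single factor \<open>w\<close> per step is enough.\<close>

lemma (in cring) idempotent_add_iterated_pow: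
  assumes e: "e \<in> carrier R" "e \<otimes> e = e" and w: "w \<in> carrier R"
    and N: "N \<ge> 2" "[(N::nat)] \<cdot> \<one> = \<zero>"
  shows "\<exists>c\<in>carrier R. (e \<oplus> w) [^] (N ^ k) = e \<oplus> w [^] (Suc k) \<otimes> c"
proof (induction k)
  case 0
  then show ?case using e w by (intro bexI[of _ \<one>]) auto
next
  case (Suc k)
  then obtain c where c: "c \<in> carrier R" "(e \<oplus> w) [^] (N ^ k) = e \<oplus> w [^] (Suc k) \<otimes> c" by blast
  define x where "x = w [^] (Suc k) \<otimes> c"
  have x: "x \<in> carrier R" using w c by (simp add: x_def)
  obtain d where d: "d \<in> carrier R" "(e \<oplus> x) [^] N = e \<oplus> [N] \<cdot> (e \<otimes> x) \<oplus> x \<otimes> x \<otimes> d"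
    using idempotent_add_pow[OF e x, of "N - 2"] N(1) by (auto simp del: add_2_eq_Suc' add_2_eq_Suc)
  have "[N] \<cdot> (e \<otimes> x) = ([N] \<cdot> \<one>) \<otimes> (e \<otimes> x)"
    using e x by (simp add: add_pow_ldistr)
  then have "(e \<oplus> x) [^] N = e \<oplus> x \<otimes> x \<otimes> d"
    using N(2) d e x by simp
  \<comment> \<open>Of the \<open>2 * k + 2\<close> factors \<open>w\<close> available,
    \<open>k + 2\<close> are kept and the other \<open>k\<close> go into the cofactor.\<close>
  also have "x \<otimes> x \<otimes> d = (w [^] k \<otimes> w \<otimes> w) \<otimes> (w [^] k \<otimes> c \<otimes> c \<otimes> d)"
    using w c(1) d(1) by (simp add: x_def m_ac)
  finally have "(e \<oplus> w) [^] (N ^ Suc k) = e \<oplus> w [^] (Suc (Suc k)) \<otimes> (w [^] k \<otimes> c \<otimes> c \<otimes> d)"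
    using c e w by (simp add: x_def nat_pow_pow[symmetric] mult.commute[of N])
  then show ?case using w c(1) d(1) by blast
qed

text \<open>As \<open>e \<otimes> e \<ominus> e\<close> vanishes, the defect is a multiple of
  \<open>w\<close>, and commutativity passes the nilpotence of \<open>w\<close> on to it.\<close>

lemma (in cring) nilpotent_idempotent_defect:
  assumes e: "e \<in> carrier R" "e \<otimes> e = e" and w: "w \<in> carrier R" "w [^] (k::nat) = \<zero>"
  shows "((e \<oplus> w) \<otimes> (e \<oplus> w) \<ominus> (e \<oplus> w)) [^] k = \<zero>"
proof -
  have "(e \<oplus> w) \<otimes> (e \<oplus> w) \<ominus> (e \<oplus> w) = (e \<otimes> e \<ominus> e) \<oplus> w \<otimes> (e \<oplus> e \<oplus> w \<ominus> \<one>)"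
    using e(1) w(1) by algebra
  also have "\<dots> = w \<otimes> (e \<oplus> e \<oplus> w \<ominus> \<one>)"
    using e w by (simp add: minus_eq r_neg)
  finally show ?thesis using e w by (simp add: nat_pow_distrib)
qed

section \<open>From pseudo polarity to periodicity\<close>

lemma (in ring) add_pow_one_mult: "[(m::nat)] \<cdot> \<one> \<otimes> [(n::nat)] \<cdot> \<one> = [(m * n)] \<cdot> \<one>"
  by (simp add: add_pow_ldistr add.nat_pow_pow mult.commute)

lemma (in ring) add_pow_one_pow: "([(m::nat)] \<cdot> \<one>) [^] (k::nat) = [(m ^ k)] \<cdot> \<one>"
  by (induction k) (simp_all add: add_pow_one_mult mult.commute)

text \<open>Take \<open>w = a [^] n \<ominus> e\<close>: some power of it lies in the radical, and
  nilness makes a further power vanish. Both \<open>a [^] n\<close> and \<open>e\<close> lie in the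
  double commutant, hence so does \<open>w\<close>.\<close>

lemma (in ring) pseudo_pi_polar_decomposition:
  assumes "pseudo_pi_polar R" "nil_subset (jacobson_radical R) R" and a: "a \<in> carrier R"
  obtains n k :: nat and e w where "n \<ge> 1"
    "e \<in> ring_double_commutant R a" "w \<in> ring_double_commutant R a"
    "e \<otimes> e = e" "w [^] k = \<zero>" "a [^] n = e \<oplus> w"
proof -
  obtain n e where n: "n \<ge> (1::nat)" and e: "e \<in> ring_double_commutant R a" "e [^] (2::nat) = e"
    and s: "a [^] n \<ominus> e \<in> sqrt_jacobson_radical R"
    using assms by (auto simp: pseudo_pi_polar_def)
  have ec: "e \<in> carrier R" using e by (simp add: ring_double_commutant_def)
  define w where "w = a [^] n \<ominus> e"
  have w: "w \<in> carrier R" using a ec by (simp add: w_def)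
  obtain i :: nat where i: "w [^] i \<in> jacobson_radical R"
    using s by (auto simp: sqrt_jacobson_radical_def w_def)
  then obtain j :: nat where j: "(w [^] i) [^] j = \<zero>"
    using assms(2) by (auto simp: nil_subset_def)
  interpret D: subcring "ring_double_commutant R a" R
    by (rule subcring_double_commutant[OF a])
  have "w \<in> ring_double_commutant R a"
    unfolding w_def minus_eq
    using subcringE(5,7)[OF D.subcring_axioms] e nat_pow_in_double_commutant[OF a] by blast
  moreover have "w [^] (i * j) = \<zero>" using j w by (simp add: nat_pow_pow)
  moreover have "e \<otimes> e = e" using e ec by (simp add: numeral_2_eq_2)
  moreover have "a [^] n = e \<oplus> w"
    unfolding w_def using nat_pow_closed[OF a, of n] ec by algebra
  ultimately show ?thesis by (intro that[OF n e(1)])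
qed

lemma (in ring) pseudo_pi_polar_imp_positive_characteristic:
  assumes "pseudo_pi_polar R" "nil_subset (jacobson_radical R) R"
  obtains N :: nat where "N \<ge> 2" "[N] \<cdot> \<one> = \<zero>"
proof -
  let ?two = "[(2::nat)] \<cdot> \<one>"
  obtain n k :: nat and e w where n: "n \<ge> 1"
    and D: "e \<in> ring_double_commutant R ?two" "w \<in> ring_double_commutant R ?two"
    and ew: "e \<otimes> e = e" "w [^] k = \<zero>" "?two [^] n = e \<oplus> w"
    by (rule pseudo_pi_polar_decomposition[OF assms add.nat_pow_closed[OF one_closed]])
  let ?D = "ring_double_commutant R ?two"
  let ?S = "R\<lparr>carrier := ?D\<rparr>"
  have sub: "subcring ?D R" by (intro subcring_double_commutant) simp
  interpret S: cring ?S
    using subcring_iff subcringE(1)[OF sub] sub by blast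
  \<comment> \<open>The definition of the additive inverse refers to the carrier, so after shrinking
    the carrier the two inverses are matched by uniqueness.\<close>
  have inv: "\<ominus>\<^bsub>?S\<^esub> x = \<ominus> x" if "x \<in> ?D" for x
  proof -
    have "x \<oplus> \<ominus>\<^bsub>?S\<^esub> x = \<zero>" using S.r_neg[of x] that by simp
    moreover have "\<ominus>\<^bsub>?S\<^esub> x \<in> ?D" using S.a_inv_closed[of x] that by simp
    ultimately show ?thesis
      using that subcringE(1)[OF sub] by (metis minus_equality a_comm subsetD)
  qed
  have b: "e \<oplus> w \<in> ?D" using D subcringE(7)[OF sub] by blast
  have "((e \<oplus> w) \<otimes> (e \<oplus> w) \<ominus> (e \<oplus> w)) [^] k = \<zero>"
    using S.nilpotent_idempotent_defect[of e w k] D ew inv[OF b]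
    by (simp add: nat_pow_consistent[symmetric] a_minus_def)
  moreover have "(e \<oplus> w) \<otimes> (e \<oplus> w) \<ominus> (e \<oplus> w) = [(4 ^ n - 2 ^ n :: nat)] \<cdot> \<one>"
  proof -
    have "(2::nat) ^ n \<le> 4 ^ n" by (simp add: power_mono)
    then have "[(4 ^ n :: nat)] \<cdot> \<one> = [(4 ^ n - 2 ^ n :: nat)] \<cdot> \<one> \<oplus> [(2 ^ n :: nat)] \<cdot> \<one>"
      by (simp add: add.nat_pow_mult)
    moreover have "(e \<oplus> w) \<otimes> (e \<oplus> w) = [(4 ^ n :: nat)] \<cdot> \<one>"
      unfolding ew(3)[symmetric] by (simp add: add_pow_one_pow add_pow_one_mult flip: power_mult_distrib)
    moreover have "e \<oplus> w = [(2 ^ n :: nat)] \<cdot> \<one>"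
      unfolding ew(3)[symmetric] by (simp add: add_pow_one_pow)
    ultimately show ?thesis by (simp add: minus_eq a_assoc r_neg)
  qed
  ultimately have "[((4 ^ n - 2 ^ n :: nat) ^ k)] \<cdot> \<one> = \<zero>"
    by (simp add: add_pow_one_pow)
  \<comment> \<open>For \<open>k = 0\<close> the power is only 1; doubling secures
    \<open>N \<ge> 2\<close> in every case.\<close>
  then have "[((4 ^ n - 2 ^ n :: nat) ^ k * 2)] \<cdot> \<one> = \<zero>"
    by (simp flip: add_pow_one_mult)
  moreover have "(2::nat) ^ n < 4 ^ n" using n by (simp add: power_strict_mono)
  then have "(4 ^ n - 2 ^ n :: nat) ^ k * 2 \<ge> 2" by simp
  ultimately show ?thesis using that by blast
qed

lemma (in ring) pseudo_pi_polar_imp_periodic: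
  assumes "pseudo_pi_polar R" "nil_subset (jacobson_radical R) R"
  shows "periodic_ring R"
  unfolding periodic_ring_def
proof
  fix a assume a: "a \<in> carrier R"
  obtain N :: nat where N: "N \<ge> 2" "[N] \<cdot> \<one> = \<zero>"
    using pseudo_pi_polar_imp_positive_characteristic[OF assms] .
  obtain n k :: nat and e w where n: "n \<ge> 1"
    and D: "e \<in> ring_double_commutant R a" "w \<in> ring_double_commutant R a"
    and ew: "e \<otimes> e = e" "w [^] k = \<zero>" "a [^] n = e \<oplus> w"
    by (rule pseudo_pi_polar_decomposition[OF assms a])
  let ?D = "ring_double_commutant R a"
  let ?S = "R\<lparr>carrier := ?D\<rparr>"
  have sub: "subcring ?D R" by (rule subcring_double_commutant[OF a])
  interpret S: cring ?S
    using subcring_iff subcringE(1)[OF sub] sub by blast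
  \<comment> \<open>Multiples are built from zero and addition alone, which the change of carrier
    leaves untouched.\<close>
  have "[N] \<cdot>\<^bsub>?S\<^esub> \<one> = [N] \<cdot> \<one>"
    by (simp add: add_pow_def nat_pow_def)
  then obtain c where c: "c \<in> ?D" "(e \<oplus> w) [^] (N ^ k) = e \<oplus> w [^] (Suc k) \<otimes> c"
    using S.idempotent_add_iterated_pow[of e w N k] D ew N
    by (auto simp: nat_pow_consistent[symmetric])
  have "e \<in> carrier R" "w \<in> carrier R" "c \<in> carrier R"
    using D c subcringE(1)[OF sub] by auto
  \<comment> \<open>With \<open>k\<close> iterations the error carries the factor
    \<open>w [^] (Suc k)\<close>, which is zero.\<close>
  then have "a [^] (n * N ^ k) = e"
    using c(2) a ew by (simp flip: nat_pow_pow)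
  then have "a [^] (n * N ^ k + n * N ^ k) = a [^] (n * N ^ k)"
    using a ew(1) by (simp flip: nat_pow_mult)
  moreover have "n * N ^ k \<ge> 1" using n N by (simp add: Suc_le_eq)
  ultimately show "\<exists>m n::nat. n < m \<and> n \<ge> 1 \<and> a [^] m = a [^] n"
    by (intro exI[of _ "n * N ^ k + n * N ^ k"] exI[of _ "n * N ^ k"]) linarith
qed

theorem theorem4p1:
  fixes R :: "('a, 'b) ring_scheme"
  assumes "ring R"
  shows "periodic_ring R \<longleftrightarrow> pseudo_pi_polar R \<and> nil_subset (jacobson_radical R) R"
proof -
  interpret ring R by fact
  show ?thesis
    using periodic_imp_pseudo_pi_polar periodic_imp_nil_jacobson_radical
      pseudo_pi_polar_imp_periodic by blast
qed

end
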